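(* Let $A$ be a unital associative algebra over a field $k$, $V$ a $k$-vector space and $\Omega(A,V)=(\triangleleft,\triangleright,\leftharpoonup,\rightharpoonup,f,\cdot)$ an extending datum of $A$ through $V$. The following statements are equivalent: (1) $A\ltimes V$ is a unified product, i.e. the multiplication $\bullet$ on $A\times V$ is associative with unit $(1_A,0_V)$. (2) The following hold for all $a,b\in A$, $x,y,z\in V$: (A1) $\Omega(A,V)$ is normalized and $(V,\rightharpoonup,\triangleleft)$ is an $A$-bimodule; (A2) $x\cdot(y\cdot z)-(x\cdot y)\cdot z=f(x,y)\rightharpoonup z-x\triangleleft f(y,z)$; (A3) $f(x,y\cdot z)-f(x\cdot y,z)=f(x,y)\leftharpoonup z-x\triangleright f(y,z)$; (A4) $a\rightharpoonup(x\cdot y)=(a\rightharpoonup x)\cdot y+(a\leftharpoonup x)\rightharpoonup y$; (A5) $(a\leftharpoonup x)\leftharpoonup y=a\leftharpoonup(x\cdot y)+a\,f(x,y)-f(a\rightharpoonup x,y)$; (A6) $(ab)\leftharpoonup x=a(b\leftharpoonup x)+a\leftharpoonup(b\rightharpoonup x)$; (A7) $x\triangleright(ab)=(x\triangleright a)b+(x\triangleleft a)\triangleright b$; (A8) $x\triangleright(y\triangleright a)=(x\cdot y)\triangleright a+f(x,y)a-f(x,y\triangleleft a)$; (A9) $(x\cdot y)\triangleleft a=x\triangleleft(y\triangleright a)+x\cdot(y\triangleleft a)$; (A10) $a(x\triangleright b)+a\leftharpoonup(x\triangleleft b)=(a\leftharpoonup x)b+(a\rightharpoonup x)\triangleright b$;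 (A11) $x\triangleright(a\leftharpoonup y)+f(x,a\rightharpoonup y)=(x\triangleright a)\leftharpoonup y+f(x\triangleleft a,y)$; (A12) $x\triangleleft(a\leftharpoonup y)+x\cdot(a\rightharpoonup y)=(x\triangleright a)\rightharpoonup y+(x\triangleleft a)\cdot y$.
   Context: All vector spaces, linear and bilinear maps are over an arbitrary field $k$. Modules are unital. An $A$-bimodule $(V,\rightharpoonup,\triangleleft)$ is a left $A$-module $(V,\rightharpoonup)$ that is also a right $A$-module $(V,\triangleleft)$ with $a\rightharpoonup(x\triangleleft b)=(a\rightharpoonup x)\triangleleft b$ for all $a,b\in A$, $x\in V$. An extending datum of $A$ through $V$ is a system $\Omega(A,V)=(\triangleleft,\triangleright,\leftharpoonup,\rightharpoonup,f,\cdot)$ of six bilinear maps $\triangleleft:V\times A\to V$, $\triangleright:V\times A\to A$, $\leftharpoonup:A\times V\to A$, $\rightharpoonup:A\times V\to V$, $f:V\times V\to A$, $\cdot:V\times V\to V$. It is normalized if $x\triangleright 1_A=0$, $x\triangleleft 1_A=x$, $1_A\leftharpoonup x=0$, $1_A\rightharpoonup x=x$ for all $x\in V$. $A\ltimes V$ denotes the vector space $A\times V$ with the bilinear multiplication $$(a,x)\bullet(b,y)=\bigl(ab+a\leftharpoonup y+x\triangleright b+f(x,y),\ a\rightharpoonup y+x\triangleleft b+x\cdot y\bigr).$$ It is called a unified product if it is an associative algebra with unit $(1_A,0_V)$. *)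

theory Defs
  imports "HOL-Analysis.Product_Vector"
begin

definition bilinear_map ::
  "('k::field \<Rightarrow> 'u::ab_group_add \<Rightarrow> 'u) \<Rightarrow> ('k \<Rightarrow> 'v::ab_group_add \<Rightarrow> 'v) \<Rightarrow>
   ('k \<Rightarrow> 'w::ab_group_add \<Rightarrow> 'w) \<Rightarrow> ('u \<Rightarrow> 'v \<Rightarrow> 'w) \<Rightarrow> bool"
  where "bilinear_map s1 s2 s3 B \<longleftrightarrow>
    (\<forall>x. Vector_Spaces.linear s2 s3 (\<lambda>y. B x y)) \<and>
    (\<forall>y. Vector_Spaces.linear s1 s3 (\<lambda>x. B x y))"

text \<open>The multiplication and the unit are explicit parameters: type classes such as \<^class>\<open>ring_1\<close>
  would exclude the zero algebra, and \<open>'a \<times> 'v\<close> has to carry the multiplication of the unified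
  product.\<close>

locale unital_algebra = vector_space scale
  for scale :: "'k::field \<Rightarrow> 'a::ab_group_add \<Rightarrow> 'a" +
  fixes mult :: "'a \<Rightarrow> 'a \<Rightarrow> 'a"
    and unit :: 'a
  assumes mult_bilinear: "bilinear_map scale scale scale mult"
    and mult_assoc: "mult (mult a b) c = mult a (mult b c)"
    and unit_left: "mult unit a = a"
    and unit_right: "mult a unit = a"

locale left_module =
  A: unital_algebra scaleA mult unit + V: vector_space scaleV
  for scaleA :: "'k::field \<Rightarrow> 'a::ab_group_add \<Rightarrow> 'a"
    and mult unit
    and scaleV :: "'k \<Rightarrow> 'v::ab_group_add \<Rightarrow> 'v" +
  fixes lact :: "'a \<Rightarrow> 'v \<Rightarrow> 'v"
  assumes lact_bilinear: "bilinear_map scaleA scaleV scaleV lact"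
    and lact_mult: "lact (mult a b) x = lact a (lact b x)"
    and lact_unit: "lact unit x = x"

locale right_module =
  A: unital_algebra scaleA mult unit + V: vector_space scaleV
  for scaleA :: "'k::field \<Rightarrow> 'a::ab_group_add \<Rightarrow> 'a"
    and mult unit
    and scaleV :: "'k \<Rightarrow> 'v::ab_group_add \<Rightarrow> 'v" +
  fixes ract :: "'v \<Rightarrow> 'a \<Rightarrow> 'v"
  assumes ract_bilinear: "bilinear_map scaleV scaleA scaleV ract"
    and ract_mult: "ract x (mult a b) = ract (ract x a) b"
    and ract_unit: "ract x unit = x"

locale bimodule =
  left_module scaleA mult unit scaleV lact + right_module scaleA mult unit scaleV ract
  for scaleA :: "'k::field \<Rightarrow> 'a::ab_group_add \<Rightarrow> 'a"
    and mult unit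
    and scaleV :: "'k \<Rightarrow> 'v::ab_group_add \<Rightarrow> 'v"
    and lact ract +
  assumes lact_ract: "lact a (ract x b) = ract (lact a x) b"

text \<open>The six maps of an extending datum are always listed in the order
  \<open>\<triangleleft>\<close>, \<open>\<triangleright>\<close>, \<open>\<leftharpoonup>\<close>, \<open>\<rightharpoonup>\<close>, \<open>f\<close>, \<open>\<cdot>\<close>.\<close>

locale extending_datum =
  A: unital_algebra scaleA mult unit + V: vector_space scaleV
  for scaleA :: "'k::field \<Rightarrow> 'a::ab_group_add \<Rightarrow> 'a"
    and mult :: "'a \<Rightarrow> 'a \<Rightarrow> 'a"
    and unit :: 'a
    and scaleV :: "'k \<Rightarrow> 'v::ab_group_add \<Rightarrow> 'v" +
  fixes tril :: "'v \<Rightarrow> 'a \<Rightarrow> 'v"  (infix "\<triangleleft>" 75)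
    and trir :: "'v \<Rightarrow> 'a \<Rightarrow> 'a"  (infix "\<triangleright>" 75)
    and harl :: "'a \<Rightarrow> 'v \<Rightarrow> 'a"  (infix "\<leftharpoonup>" 75)
    and harr :: "'a \<Rightarrow> 'v \<Rightarrow> 'v"  (infix "\<rightharpoonup>" 75)
    and f :: "'v \<Rightarrow> 'v \<Rightarrow> 'a"
    and dt :: "'v \<Rightarrow> 'v \<Rightarrow> 'v"  (infix "\<cdot>" 75)
  assumes tril_bilinear: "bilinear_map scaleV scaleA scaleV (\<triangleleft>)"
    and trir_bilinear: "bilinear_map scaleV scaleA scaleA (\<triangleright>)"
    and harl_bilinear: "bilinear_map scaleA scaleV scaleA (\<leftharpoonup>)"
    and harr_bilinear: "bilinear_map scaleA scaleV scaleV (\<rightharpoonup>)"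
    and f_bilinear: "bilinear_map scaleV scaleV scaleA f"
    and dt_bilinear: "bilinear_map scaleV scaleV scaleV (\<cdot>)"

definition normalized ::
  "'a::ab_group_add \<Rightarrow> ('v \<Rightarrow> 'a \<Rightarrow> 'v) \<Rightarrow> ('v \<Rightarrow> 'a \<Rightarrow> 'a) \<Rightarrow> ('a \<Rightarrow> 'v \<Rightarrow> 'a) \<Rightarrow> ('a \<Rightarrow> 'v \<Rightarrow> 'v) \<Rightarrow> bool"
  where "normalized unit tril trir harl harr \<longleftrightarrow>
    (\<forall>x. trir x unit = 0 \<and> tril x unit = x \<and> harl unit x = 0 \<and> harr unit x = x)"

definition unified_mult ::
  "('a::ab_group_add \<Rightarrow> 'a \<Rightarrow> 'a) \<Rightarrow>
   ('v::ab_group_add \<Rightarrow> 'a \<Rightarrow> 'v) \<Rightarrow> ('v \<Rightarrow> 'a \<Rightarrow> 'a) \<Rightarrow> ('a \<Rightarrow> 'v \<Rightarrow> 'a) \<Rightarrow> ('a \<Rightarrow> 'v \<Rightarrow> 'v) \<Rightarrow>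
   ('v \<Rightarrow> 'v \<Rightarrow> 'a) \<Rightarrow> ('v \<Rightarrow> 'v \<Rightarrow> 'v) \<Rightarrow> 'a \<times> 'v \<Rightarrow> 'a \<times> 'v \<Rightarrow> 'a \<times> 'v"
  where "unified_mult mult tril trir harl harr f dt = (\<lambda>(a, x) (b, y).
    (mult a b + harl a y + trir x b + f x y, harr a y + tril x b + dt x y))"

definition unified_product ::
  "('k::field \<Rightarrow> 'a::ab_group_add \<Rightarrow> 'a) \<Rightarrow> ('a \<Rightarrow> 'a \<Rightarrow> 'a) \<Rightarrow> 'a \<Rightarrow> ('k \<Rightarrow> 'v::ab_group_add \<Rightarrow> 'v) \<Rightarrow>
   ('v \<Rightarrow> 'a \<Rightarrow> 'v) \<Rightarrow> ('v \<Rightarrow> 'a \<Rightarrow> 'a) \<Rightarrow> ('a \<Rightarrow> 'v \<Rightarrow> 'a) \<Rightarrow> ('a \<Rightarrow> 'v \<Rightarrow> 'v) \<Rightarrow>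
   ('v \<Rightarrow> 'v \<Rightarrow> 'a) \<Rightarrow> ('v \<Rightarrow> 'v \<Rightarrow> 'v) \<Rightarrow> bool"
  where "unified_product scaleA mult unit scaleV tril trir harl harr f dt \<longleftrightarrow>
    unital_algebra (module_prod.scale scaleA scaleV)
      (unified_mult mult tril trir harl harr f dt) (unit, 0)"

end

theory Submission
  imports Defs
begin

text \<open>The product \<open>\<bullet>\<close> is bilinear because all the maps it is built from
  are, so only the unit laws and associativity are at stake. Multiplying by \<open>(unit, 0)\<close>
  on either side and reading off coordinates turns the unit laws into normalization. The associator
  is trilinear, so it vanishes as soon as it vanishes with each argument taken from A or from V:
  eight types of triples. The type AAA is associativity of A. Each of the other seven gives one
  equation in A and one in V, fourteen in total: the left module, right module and compatibility
  laws of the bimodule, and the eleven remaining identities. \<open>assoc_iff\<close> carries the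
  reduction to types; \<open>unit_iff_normalized\<close> and \<open>bimodule_iff\<close> account for
  the units and the module laws.\<close>

lemma bilinear_map_iff:
  assumes "vector_space s1" "vector_space s2" "vector_space s3"
  shows "bilinear_map s1 s2 s3 B \<longleftrightarrow>
    (\<forall>x x' y. B (x + x') y = B x y + B x' y) \<and> (\<forall>x y y'. B x (y + y') = B x y + B x y') \<and>
    (\<forall>c x y. B (s1 c x) y = s3 c (B x y)) \<and> (\<forall>c x y. B x (s2 c y) = s3 c (B x y))"
  using assms by (auto simp: bilinear_map_def Vector_Spaces.linear_iff)

lemma bilinear_map_add:
  assumes "bilinear_map s1 s2 s3 B"
  shows "B (x + x') y = B x y + B x' y" "B x (y + y') = B x y + B x y'"
  using assms by (auto simp: bilinear_map_def Vector_Spaces.linear_iff)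

lemma bilinear_map_scale:
  assumes "bilinear_map s1 s2 s3 B"
  shows "B (s1 c x) y = s3 c (B x y)" "B x (s2 c y) = s3 c (B x y)"
  using assms by (auto simp: bilinear_map_def Vector_Spaces.linear_iff)

text \<open>Additivity at \<open>0 + 0\<close> and cancellation. These laws collapse products of
  elements \<open>(a, 0)\<close> and \<open>(0, x)\<close> to the few terms that survive.\<close>

lemma bilinear_map_zero:
  assumes "bilinear_map s1 s2 s3 B"
  shows "B 0 y = 0" "B x 0 = 0"
  using bilinear_map_add(1)[OF assms, of 0 0 y] bilinear_map_add(2)[OF assms, of x 0 0] by auto

context extending_datum
begin

lemmas bilinear = A.mult_bilinear tril_bilinear trir_bilinear harl_bilinear harr_bilinear
  f_bilinear dt_bilinear

lemmas add_simps = bilinear[THEN bilinear_map_add(1)] bilinear[THEN bilinear_map_add(2)]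
lemmas scale_simps = bilinear[THEN bilinear_map_scale(1)] bilinear[THEN bilinear_map_scale(2)]
lemmas zero_simps = bilinear[THEN bilinear_map_zero(1)] bilinear[THEN bilinear_map_zero(2)]

abbreviation prod_mult :: "'a \<times> 'v \<Rightarrow> 'a \<times> 'v \<Rightarrow> 'a \<times> 'v"  (infix "\<bullet>" 75)
  where "(\<bullet>) \<equiv> unified_mult mult (\<triangleleft>) (\<triangleright>) (\<leftharpoonup>) (\<rightharpoonup>) f (\<cdot>)"

lemma prod_mult_Pair:
  "(a, x) \<bullet> (b, y) = (mult a b + a \<leftharpoonup> y + x \<triangleright> b + f x y, a \<rightharpoonup> y + x \<triangleleft> b + x \<cdot> y)"
  by (simp add: unified_mult_def)

sublocale prod: vector_space_prod scaleA scaleV ..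

lemma prod_mult_bilinear: "bilinear_map prod.scale prod.scale prod.scale (\<bullet>)"
  unfolding bilinear_map_iff[OF prod.p.vector_space_axioms prod.p.vector_space_axioms prod.p.vector_space_axioms]
  by (auto simp: prod_mult_Pair prod.scale_def add_simps scale_simps A.scale_right_distrib
      V.scale_right_distrib algebra_simps)

text \<open>The vector space structure on the product and the bilinearity of
  \<open>\<bullet>\<close> come for free, which leaves the associative and unit laws.\<close>

lemma unified_product_iff:
  "unified_product scaleA mult unit scaleV (\<triangleleft>) (\<triangleright>) (\<leftharpoonup>) (\<rightharpoonup>) f (\<cdot>) \<longleftrightarrow>
    (\<forall>p q r. (p \<bullet> q) \<bullet> r = p \<bullet> (q \<bullet> r)) \<and> (\<forall>p. (unit, 0) \<bullet> p = p \<and> p \<bullet> (unit, 0) = p)"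
  using prod_mult_bilinear prod.p.vector_space_axioms
  by (auto simp: unified_product_def unital_algebra_def unital_algebra_axioms_def)

text \<open>By vanishing at 0, \<open>(unit, 0) \<bullet> (b, y)\<close> is
  \<open>(b + unit \<leftharpoonup> y, unit \<rightharpoonup> y)\<close> and
  \<open>(a, x) \<bullet> (unit, 0)\<close> is
  \<open>(a + x \<triangleright> unit, x \<triangleleft> unit)\<close>.\<close>

lemma unit_iff_normalized:
  "(\<forall>p. (unit, 0) \<bullet> p = p \<and> p \<bullet> (unit, 0) = p) \<longleftrightarrow> normalized unit (\<triangleleft>) (\<triangleright>) (\<leftharpoonup>) (\<rightharpoonup>)"
  by (auto simp: prod_mult_Pair zero_simps normalized_def A.unit_left A.unit_right)

text \<open>Normalization supplies both unit laws of the actions and the extending datum their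
  bilinearity, so three equations remain. These are the ones that appear as V-coordinates of
  associativity.\<close>

lemma bimodule_iff:
  assumes "normalized unit (\<triangleleft>) (\<triangleright>) (\<leftharpoonup>) (\<rightharpoonup>)"
  shows "bimodule scaleA mult unit scaleV (\<rightharpoonup>) (\<triangleleft>) \<longleftrightarrow>
    (\<forall>a b x. mult a b \<rightharpoonup> x = a \<rightharpoonup> (b \<rightharpoonup> x)) \<and> (\<forall>a b x. x \<triangleleft> mult a b = (x \<triangleleft> a) \<triangleleft> b) \<and>
    (\<forall>a b x. a \<rightharpoonup> (x \<triangleleft> b) = (a \<rightharpoonup> x) \<triangleleft> b)"
  using assms A.unital_algebra_axioms V.vector_space_axioms harr_bilinear tril_bilinear
  by (auto simp: bimodule_def bimodule_axioms_def left_module_def left_module_axioms_def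
      right_module_def right_module_axioms_def normalized_def)

text \<open>Both sides are additive in each argument, so it suffices to compare them on the summands
  \<open>(a, 0)\<close> and \<open>(0, x)\<close>.\<close>

lemma assoc_iff:
  "(\<forall>p q r. (p \<bullet> q) \<bullet> r = p \<bullet> (q \<bullet> r)) \<longleftrightarrow>
    (\<forall>a b x. ((a, 0) \<bullet> (b, 0)) \<bullet> (0, x) = (a, 0) \<bullet> ((b, 0) \<bullet> (0, x))) \<and>
    (\<forall>a b x. ((a, 0) \<bullet> (0, x)) \<bullet> (b, 0) = (a, 0) \<bullet> ((0, x) \<bullet> (b, 0))) \<and>
    (\<forall>a b x. ((0, x) \<bullet> (a, 0)) \<bullet> (b, 0) = (0, x) \<bullet> ((a, 0) \<bullet> (b, 0))) \<and>
    (\<forall>a x y. ((a, 0) \<bullet> (0, x)) \<bullet> (0, y) = (a, 0) \<bullet> ((0, x) \<bullet> (0, y))) \<and>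
    (\<forall>a x y. ((0, x) \<bullet> (a, 0)) \<bullet> (0, y) = (0, x) \<bullet> ((a, 0) \<bullet> (0, y))) \<and>
    (\<forall>a x y. ((0, x) \<bullet> (0, y)) \<bullet> (a, 0) = (0, x) \<bullet> ((0, y) \<bullet> (a, 0))) \<and>
    (\<forall>x y z. ((0, x) \<bullet> (0, y)) \<bullet> (0, z) = (0, x) \<bullet> ((0, y) \<bullet> (0, z)))"
  (is "?L \<longleftrightarrow> ?R")
proof
  assume R: ?R
  have AAA: "((a, 0) \<bullet> (b, 0)) \<bullet> (c, 0) = (a, 0) \<bullet> ((b, 0) \<bullet> (c, 0))" for a b c
    by (simp add: prod_mult_Pair zero_simps A.mult_assoc)
  show ?L
  proof (intro allI)
    fix p q r
    have split: "p = (fst p, 0) + (0, snd p)" for p :: "'a \<times> 'v"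
      by simp
    show "(p \<bullet> q) \<bullet> r = p \<bullet> (q \<bullet> r)"
      \<comment> \<open>The equation \<open>split\<close> would loop as a simplification rule, so it
        is applied once to the two occurrences of each variable. Additivity then yields eight
        summands on each side, which agree type by type.\<close>
      by (subst (1 2) split[of p], subst (1 2) split[of q], subst (1 2) split[of r])
        (simp only: bilinear_map_add[OF prod_mult_bilinear] R AAA ac_simps)
  qed
next
  assume ?L
  then show ?R
    by simp
qed

end

theorem theorem1p2:
  fixes scaleA :: "'k::field \<Rightarrow> 'a::ab_group_add \<Rightarrow> 'a"
    and mult :: "'a \<Rightarrow> 'a \<Rightarrow> 'a"  (infix "\<star>" 75)
    and unit :: 'a
    and scaleV :: "'k \<Rightarrow> 'v::ab_group_add \<Rightarrow> 'v"
    and tril :: "'v \<Rightarrow> 'a \<Rightarrow> 'v"  (infix "\<triangleleft>" 75)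
    and trir :: "'v \<Rightarrow> 'a \<Rightarrow> 'a"  (infix "\<triangleright>" 75)
    and harl :: "'a \<Rightarrow> 'v \<Rightarrow> 'a"  (infix "\<leftharpoonup>" 75)
    and harr :: "'a \<Rightarrow> 'v \<Rightarrow> 'v"  (infix "\<rightharpoonup>" 75)
    and f :: "'v \<Rightarrow> 'v \<Rightarrow> 'a"
    and dt :: "'v \<Rightarrow> 'v \<Rightarrow> 'v"  (infix "\<cdot>" 75)
  assumes "unital_algebra scaleA (\<star>) unit"
    and "vector_space scaleV"
    and "extending_datum scaleA (\<star>) unit scaleV (\<triangleleft>) (\<triangleright>) (\<leftharpoonup>) (\<rightharpoonup>) f (\<cdot>)"
  shows "unified_product scaleA (\<star>) unit scaleV (\<triangleleft>) (\<triangleright>) (\<leftharpoonup>) (\<rightharpoonup>) f (\<cdot>) \<longleftrightarrow>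
    (normalized unit (\<triangleleft>) (\<triangleright>) (\<leftharpoonup>) (\<rightharpoonup>) \<and> bimodule scaleA (\<star>) unit scaleV (\<rightharpoonup>) (\<triangleleft>)) \<and>
    (\<forall>x y z. x \<cdot> (y \<cdot> z) - (x \<cdot> y) \<cdot> z = f x y \<rightharpoonup> z - x \<triangleleft> f y z) \<and>
    (\<forall>x y z. f x (y \<cdot> z) - f (x \<cdot> y) z = f x y \<leftharpoonup> z - x \<triangleright> f y z) \<and>
    (\<forall>a x y. a \<rightharpoonup> (x \<cdot> y) = (a \<rightharpoonup> x) \<cdot> y + (a \<leftharpoonup> x) \<rightharpoonup> y) \<and>
    (\<forall>a x y. (a \<leftharpoonup> x) \<leftharpoonup> y = a \<leftharpoonup> (x \<cdot> y) + a \<star> f x y - f (a \<rightharpoonup> x) y) \<and>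
    (\<forall>a b x. (a \<star> b) \<leftharpoonup> x = a \<star> (b \<leftharpoonup> x) + a \<leftharpoonup> (b \<rightharpoonup> x)) \<and>
    (\<forall>a b x. x \<triangleright> (a \<star> b) = (x \<triangleright> a) \<star> b + (x \<triangleleft> a) \<triangleright> b) \<and>
    (\<forall>a x y. x \<triangleright> (y \<triangleright> a) = (x \<cdot> y) \<triangleright> a + f x y \<star> a - f x (y \<triangleleft> a)) \<and>
    (\<forall>a x y. (x \<cdot> y) \<triangleleft> a = x \<triangleleft> (y \<triangleright> a) + x \<cdot> (y \<triangleleft> a)) \<and>
    (\<forall>a b x. a \<star> (x \<triangleright> b) + a \<leftharpoonup> (x \<triangleleft> b) = (a \<leftharpoonup> x) \<star> b + (a \<rightharpoonup> x) \<triangleright> b) \<and>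
    (\<forall>a x y. x \<triangleright> (a \<leftharpoonup> y) + f x (a \<rightharpoonup> y) = (x \<triangleright> a) \<leftharpoonup> y + f (x \<triangleleft> a) y) \<and>
    (\<forall>a x y. x \<triangleleft> (a \<leftharpoonup> y) + x \<cdot> (a \<rightharpoonup> y) = (x \<triangleright> a) \<rightharpoonup> y + (x \<triangleleft> a) \<cdot> y)"
proof -
  interpret extending_datum scaleA mult unit scaleV tril trir harl harr f dt
    by fact
  show ?thesis
  \<comment> \<open>Both sides of the theorem entail normalization, so they fail together without
    it; with it, \<open>bimodule_iff\<close> applies.\<close>
  proof (cases "normalized unit tril trir harl harr")
    case True
    note expand = prod_mult_Pair zero_simps
    \<comment> \<open>Each type of triple is compared coordinatewise. The three types with two
      arguments from A produce, as V-coordinates, the left module law here, then the compatibility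
      of the two actions, then the right module law.\<close>
    have "((a, 0) \<bullet> (b, 0)) \<bullet> (0, x) = (a, 0) \<bullet> ((b, 0) \<bullet> (0, x)) \<longleftrightarrow>
        (a \<star> b) \<leftharpoonup> x = a \<star> (b \<leftharpoonup> x) + a \<leftharpoonup> (b \<rightharpoonup> x) \<and> (a \<star> b) \<rightharpoonup> x = a \<rightharpoonup> (b \<rightharpoonup> x)"
      for a b x
      by (simp add: expand algebra_simps)
    moreover have "((a, 0) \<bullet> (0, x)) \<bullet> (b, 0) = (a, 0) \<bullet> ((0, x) \<bullet> (b, 0)) \<longleftrightarrow>
        a \<star> (x \<triangleright> b) + a \<leftharpoonup> (x \<triangleleft> b) = (a \<leftharpoonup> x) \<star> b + (a \<rightharpoonup> x) \<triangleright> b \<and>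
        a \<rightharpoonup> (x \<triangleleft> b) = (a \<rightharpoonup> x) \<triangleleft> b" for a b x
      by (auto simp: expand)
    moreover have "((0, x) \<bullet> (a, 0)) \<bullet> (b, 0) = (0, x) \<bullet> ((a, 0) \<bullet> (b, 0)) \<longleftrightarrow>
        x \<triangleright> (a \<star> b) = (x \<triangleright> a) \<star> b + (x \<triangleleft> a) \<triangleright> b \<and> x \<triangleleft> (a \<star> b) = (x \<triangleleft> a) \<triangleleft> b"
      for a b x
      by (auto simp: expand)
    moreover have "((a, 0) \<bullet> (0, x)) \<bullet> (0, y) = (a, 0) \<bullet> ((0, x) \<bullet> (0, y)) \<longleftrightarrow>
        (a \<leftharpoonup> x) \<leftharpoonup> y = a \<leftharpoonup> (x \<cdot> y) + a \<star> f x y - f (a \<rightharpoonup> x) y \<and>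
        a \<rightharpoonup> (x \<cdot> y) = (a \<rightharpoonup> x) \<cdot> y + (a \<leftharpoonup> x) \<rightharpoonup> y" for a x y
      by (auto simp: expand algebra_simps)
    moreover have "((0, x) \<bullet> (a, 0)) \<bullet> (0, y) = (0, x) \<bullet> ((a, 0) \<bullet> (0, y)) \<longleftrightarrow>
        x \<triangleright> (a \<leftharpoonup> y) + f x (a \<rightharpoonup> y) = (x \<triangleright> a) \<leftharpoonup> y + f (x \<triangleleft> a) y \<and>
        x \<triangleleft> (a \<leftharpoonup> y) + x \<cdot> (a \<rightharpoonup> y) = (x \<triangleright> a) \<rightharpoonup> y + (x \<triangleleft> a) \<cdot> y" for a x y
      by (auto simp: expand)
    moreover have "((0, x) \<bullet> (0, y)) \<bullet> (a, 0) = (0, x) \<bullet> ((0, y) \<bullet> (a, 0)) \<longleftrightarrow>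
        x \<triangleright> (y \<triangleright> a) = (x \<cdot> y) \<triangleright> a + f x y \<star> a - f x (y \<triangleleft> a) \<and>
        (x \<cdot> y) \<triangleleft> a = x \<triangleleft> (y \<triangleright> a) + x \<cdot> (y \<triangleleft> a)" for a x y
      by (auto simp: expand algebra_simps)
    \<comment> \<open>The A-coordinate is a cocycle-type condition on \<open>f\<close>; the
      V-coordinate measures how far \<open>\<cdot>\<close> is from being associative.\<close>
    moreover have "((0, x) \<bullet> (0, y)) \<bullet> (0, z) = (0, x) \<bullet> ((0, y) \<bullet> (0, z)) \<longleftrightarrow>
        f x (y \<cdot> z) - f (x \<cdot> y) z = f x y \<leftharpoonup> z - x \<triangleright> f y z \<and>
        x \<cdot> (y \<cdot> z) - (x \<cdot> y) \<cdot> z = f x y \<rightharpoonup> z - x \<triangleleft> f y z" for x y z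
      by (auto simp: expand algebra_simps)
    ultimately show ?thesis
      unfolding unified_product_iff unit_iff_normalized bimodule_iff[OF True] assoc_iff
      \<comment> \<open>Once the seven equivalences are substituted and the quantifiers distributed
        over conjunctions, both sides consist of the same statements, and only a propositional
        rearrangement is left.\<close>
      by (simp only: all_conj_distrib) argo
  next
    case False
    then show ?thesis
      unfolding unified_product_iff unit_iff_normalized by blast
  qed
qed

end
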